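(* Fix integers $k>3$ and $2\le r\le k$. Let $H$ be the binomial random $k$-uniform hypergraph $\mathbb{G}_k(n,n^{3-k})$ on $n$ vertices, in which each of the $\binom nk$ possible edges is present independently with probability $n^{3-k}$. Then there is a constant $C=C(k,r)$ such that with probability $1-o(1)$ as $n\to\infty$, every $r$-cut of $H$ has excess at most $Cn^2$ (and $Cn^2=O(m^{2/3})$, where $m$ is the number of edges of $H$).
   Context: For $2\le r\le k$, an $r$-cut of a $k$-uniform hypergraph $H$ is a partition of $V(H)$ into $r$ labelled parts; its size is the number of edges having a vertex in every part. The excess of an $r$-cut of an $m$-edge $k$-uniform hypergraph is its size minus $\frac{S(k,r)r!}{r^k}m$, where $S(k,r)$ is the Stirling number of the second kind. *)

theory Defs
  imports "HOL-Probability.Probability" "HOL-Combinatorics.Stirling"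
begin

text \<open>A hypergraph is a pair of a vertex set and an edge set.\<close>

type_synonym 'a hypergraph = "'a set \<times> 'a set set"

abbreviation hverts :: "'a hypergraph \<Rightarrow> 'a set" where
  "hverts H \<equiv> fst H"

abbreviation hedges :: "'a hypergraph \<Rightarrow> 'a set set" where
  "hedges H \<equiv> snd H"

text \<open>The labels are \<open>0, \<dots>, r - 1\<close>. Parts may be empty, as is usual for cuts (the average
  \<open>S(k,r) r! / r^k m\<close> is over all assignments of labels to vertices); a cut with an empty part has
  size zero. Values \<open>P i\<close> with \<open>i \<ge> r\<close> are irrelevant.\<close>

definition is_cut :: "nat \<Rightarrow> 'a hypergraph \<Rightarrow> (nat \<Rightarrow> 'a set) \<Rightarrow> bool" where
  "is_cut r H P \<longleftrightarrow> disjoint_family_on P {..<r} \<and> (\<Union>i<r. P i) = hverts H"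

definition cut_size :: "nat \<Rightarrow> 'a hypergraph \<Rightarrow> (nat \<Rightarrow> 'a set) \<Rightarrow> nat" where
  "cut_size r H P = card {e \<in> hedges H. \<forall>i<r. e \<inter> P i \<noteq> {}}"

text \<open>\<open>Stirling\<close> is the library's Stirling number of the second kind. The uniformity \<open>k\<close> is passed
  explicitly, since it is not determined by a hypergraph without edges.\<close>

definition excess :: "nat \<Rightarrow> nat \<Rightarrow> 'a hypergraph \<Rightarrow> (nat \<Rightarrow> 'a set) \<Rightarrow> real" where
  "excess k r H P =
     real (cut_size r H P) - real (Stirling k r) * fact r / real r ^ k * real (card (hedges H))"

definition k_subsets :: "nat \<Rightarrow> 'a set \<Rightarrow> 'a set set" where
  "k_subsets k V = {e. e \<subseteq> V \<and> card e = k}"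

definition binomial_hypergraph :: "nat \<Rightarrow> nat \<Rightarrow> real \<Rightarrow> nat hypergraph pmf" where
  "binomial_hypergraph k n p =
     map_pmf (\<lambda>present. ({..<n}, {e \<in> k_subsets k {..<n}. present e}))
       (Pi_pmf (k_subsets k {..<n}) False (\<lambda>_. bernoulli_pmf p))"

end

theory Submission
  imports Defs
    "HOL-Computational_Algebra.Formal_Power_Series"
    "HOL-Combinatorics.Multiset_Permutations"
    "HOL-Real_Asymp.Real_Asymp"
begin

text \<open>
  For a fixed labelling of the vertices by \<open>r\<close> colours, the number of lists of length \<open>k\<close> using every
  colour is \<open>k!\<close> times the coefficient of \<open>t ^ k\<close> in \<open>\<Prod>j<r. (exp (x j * t) - 1)\<close>, where the \<open>x j\<close> are the
  sizes of the colour classes. By smoothing, this is largest for equal classes, where it is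
  \<open>S(k,r) r! (n/r) ^ k\<close>; repeated vertices account only for \<open>O(n ^ (k-1))\<close> lists, so every cut of the
  random hypergraph has mean excess \<open>O(n\<^sup>2)\<close>. The excess is a sum of independent terms with total
  variance at most \<open>n\<^sup>3\<close>, so by an exponential moment bound it deviates by \<open>c n\<^sup>2\<close> with probability
  at most \<open>exp (- (c - 1) n)\<close>, which beats the number \<open>r ^ n\<close> of cuts. The same bound shows that the
  number of edges is of order \<open>n\<^sup>3\<close>.
\<close>

section \<open>Smoothing products of exponential series\<close>

text \<open>Convexity of the \<open>m\<close>-th power: \<open>c ^ m - a ^ m\<close> and
  \<open>b ^ m - d ^ m\<close> share the factor \<open>c - a = b - d\<close>, and their cofactors
  compare termwise because \<open>a \<le> d\<close> and \<open>c \<le> b\<close>.\<close>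

lemma power_sum_le_of_between:
  fixes a b c d :: real
  assumes "0 \<le> a" "a \<le> c" "c \<le> b" "c + d = a + b"
  shows "c ^ m + d ^ m \<le> a ^ m + b ^ m"
proof -
  have "c ^ m - a ^ m = (c - a) * (\<Sum>i<m. a ^ (m - Suc i) * c ^ i)"
    by (rule power_diff_sumr2)
  also have "\<dots> \<le> (c - a) * (\<Sum>i<m. d ^ (m - Suc i) * b ^ i)"
    using assms by (intro mult_left_mono sum_mono mult_mono power_mono) auto
  also have "\<dots> = b ^ m - d ^ m"
  proof -
    have "c - a = b - d" using assms(4) by simp
    then show ?thesis by (simp only: power_diff_sumr2[of b m d])
  qed
  finally show ?thesis by simp
qed

text \<open>Expanding gives \<open>fps_exp (a + b) - fps_exp a - fps_exp b + 1\<close>. The sum of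
  the two arguments is fixed, so only the subtracted exponentials change, and by convexity their
  joint coefficient drops.\<close>

lemma fps_exp_prod_nth_mono:
  fixes a b c d :: real
  assumes "0 \<le> a" "a \<le> c" "c \<le> b" "c + d = a + b"
  shows "fps_nth ((fps_exp a - 1) * (fps_exp b - 1)) m
           \<le> fps_nth ((fps_exp c - 1) * (fps_exp d - 1)) m"
proof -
  have expand: "(fps_exp x - 1) * (fps_exp y - 1) = fps_exp (x + y) - fps_exp x - fps_exp y + 1"
    for x y :: real
    by (simp add: fps_exp_add_mult algebra_simps)
  have "c ^ m / fact m + d ^ m / fact m \<le> a ^ m / fact m + b ^ m / fact m"
    using power_sum_le_of_between[OF assms] by (simp flip: add_divide_distrib add: divide_right_mono)
  then show ?thesis
    using assms(4) by (simp add: expand)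
qed

lemma fps_prod_nth_nonneg:
  fixes F :: "'a \<Rightarrow> real fps"
  assumes "\<And>i m. i \<in> A \<Longrightarrow> 0 \<le> fps_nth (F i) m"
  shows "0 \<le> fps_nth (\<Prod>i\<in>A. F i) m"
  using assms
proof (induction A arbitrary: m rule: infinite_finite_induct)
  case (insert i A)
  then show ?case
    by (auto simp: fps_mult_nth intro!: sum_nonneg mult_nonneg_nonneg)
qed auto

lemma fps_exp_minus_1_nth_nonneg: "0 \<le> (a::real) \<Longrightarrow> 0 \<le> fps_nth (fps_exp a - 1) m"
  by (cases m) auto

lemma fps_mult_right_nth_mono:
  fixes F G H :: "real fps"
  assumes "\<And>m. fps_nth F m \<le> fps_nth G m" "\<And>m. 0 \<le> fps_nth H m"
  shows "fps_nth (F * H) m \<le> fps_nth (G * H) m"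
  using assms by (auto simp: fps_mult_nth intro!: sum_mono mult_right_mono)

text \<open>Smoothing: as long as the numbers are not all equal, some pair lies on both sides of the mean,
  and moving one of the two onto the mean (keeping their sum) increases every coefficient.\<close>

lemma fps_exp_prod_nth_le_mean:
  fixes x :: "'a \<Rightarrow> real" and \<mu> :: real
  assumes "finite A" "\<And>i. i \<in> A \<Longrightarrow> 0 \<le> x i" "(\<Sum>i\<in>A. x i) = real (card A) * \<mu>"
  shows "fps_nth (\<Prod>i\<in>A. fps_exp (x i) - 1) m \<le> fps_nth ((fps_exp \<mu> - 1) ^ card A) m"
  using assms(2,3)
\<comment> \<open>Measure: the number of entries off the mean. A smoothing step puts entry
  \<open>i\<close> on the mean and otherwise changes only entry \<open>j\<close>, which was counted
  already, so the measure drops.\<close>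
proof (induction "card {i \<in> A. x i \<noteq> \<mu>}" arbitrary: x rule: less_induct)
  case less
  show ?case
  proof (cases "\<forall>i\<in>A. x i = \<mu>")
    case True
    then show ?thesis by simp
  next
    case False
    then obtain j0 where j0: "j0 \<in> A" "x j0 \<noteq> \<mu>" by blast
    have sum0: "(\<Sum>i\<in>A. x i) = (\<Sum>i\<in>A. \<mu>)" using less.prems(2) by simp
    have "\<exists>i\<in>A. x i < \<mu>"
    proof (rule ccontr)
      assume "\<not> ?thesis"
      then have "(\<Sum>i\<in>A. \<mu>) < (\<Sum>i\<in>A. x i)"
        using j0 \<open>finite A\<close> by (intro sum_strict_mono_ex1) (auto simp: not_less neq_iff)
      with sum0 show False by simp
    qed
    then obtain i where i: "i \<in> A" "x i < \<mu>" by blast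
    have "\<exists>j\<in>A. \<mu> < x j"
    proof (rule ccontr)
      assume "\<not> ?thesis"
      then have "(\<Sum>i\<in>A. x i) < (\<Sum>i\<in>A. \<mu>)"
        using j0 \<open>finite A\<close> by (intro sum_strict_mono_ex1) (auto simp: not_less neq_iff)
      with sum0 show False by simp
    qed
    then obtain j where j: "j \<in> A" "\<mu> < x j" by blast
    have "i \<noteq> j" using i j by auto
    define y where "y = x(i := \<mu>, j := x i + x j - \<mu>)"
    have split: "g (A::'a set) = g (insert i (insert j (A - {i, j})))" for g :: "'a set \<Rightarrow> 'b"
      using i j by (intro arg_cong[of _ _ g]) auto
    have prod_split: "(\<Prod>l\<in>A. fps_exp (z l) - 1) =
        (fps_exp (z i) - 1) * (fps_exp (z j) - 1) * (\<Prod>l\<in>A - {i, j}. fps_exp (z l) - 1)"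
      for z :: "'a \<Rightarrow> real"
      using \<open>finite A\<close> \<open>i \<noteq> j\<close> by (subst split) (simp add: mult.assoc)
    have sum_split: "(\<Sum>l\<in>A. z l) = z i + z j + (\<Sum>l\<in>A - {i, j}. z l)" for z :: "'a \<Rightarrow> real"
      using \<open>finite A\<close> \<open>i \<noteq> j\<close> by (subst split) (simp add: add.assoc)
    have rest: "(\<Prod>l\<in>A - {i, j}. fps_exp (y l) - 1) = (\<Prod>l\<in>A - {i, j}. fps_exp (x l) - 1)"
      by (intro prod.cong) (auto simp: y_def)
    \<comment> \<open>The factors outside \<open>{i, j}\<close> are untouched and have nonnegative
      coefficients, so the gain on the pair passes to the whole product.\<close>
    have "fps_nth (\<Prod>i\<in>A. fps_exp (x i) - 1) m \<le> fps_nth (\<Prod>i\<in>A. fps_exp (y i) - 1) m"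
      unfolding prod_split rest
    proof (rule fps_mult_right_nth_mono)
      show "fps_nth ((fps_exp (x i) - 1) * (fps_exp (x j) - 1)) m
          \<le> fps_nth ((fps_exp (y i) - 1) * (fps_exp (y j) - 1)) m" for m
        using i j \<open>i \<noteq> j\<close> less.prems(1) by (intro fps_exp_prod_nth_mono) (auto simp: y_def)
      show "0 \<le> fps_nth (\<Prod>l\<in>A - {i, j}. fps_exp (x l) - 1) m" for m
        using less.prems(1) by (intro fps_prod_nth_nonneg fps_exp_minus_1_nth_nonneg) auto
    qed
    also have "\<dots> \<le> fps_nth ((fps_exp \<mu> - 1) ^ card A) m"
    proof (rule less.hyps)
      have "{l \<in> A. y l \<noteq> \<mu>} \<subset> {l \<in> A. x l \<noteq> \<mu>}"
        using i j \<open>i \<noteq> j\<close> by (auto simp: y_def)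
      then show "card {l \<in> A. y l \<noteq> \<mu>} < card {l \<in> A. x l \<noteq> \<mu>}"
        using \<open>finite A\<close> by (intro psubset_card_mono) auto
      show "0 \<le> y l" if "l \<in> A" for l
        using that i j less.prems(1)[of l] less.prems(1)[of i] by (auto simp: y_def)
      have "(\<Sum>l\<in>A. y l) = (\<Sum>l\<in>A. x l)"
      proof -
        have "(\<Sum>l\<in>A - {i, j}. y l) = (\<Sum>l\<in>A - {i, j}. x l)"
          by (intro sum.cong) (auto simp: y_def)
        then show ?thesis
          using \<open>i \<noteq> j\<close> by (simp add: sum_split[of y] sum_split[of x]) (simp add: y_def)
      qed
      then show "(\<Sum>l\<in>A. y l) = card A * \<mu>" using less.prems(2) by simp
    qed
    finally show ?thesis .
  qed
qed

section \<open>Generating functions of Stirling numbers and of onto lists\<close>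

text \<open>With \<open>F = fps_exp c - 1\<close>, the derivative of \<open>F ^ r\<close> is
  \<open>r * c * (F ^ r + F ^ (r - 1))\<close>, since \<open>fps_exp c = F + 1\<close>. Read
  coefficientwise, this is the recurrence of \<open>Stirling k r * fact r\<close>, scaled by
  \<open>c ^ k\<close>.\<close>

lemma fps_exp_minus_1_power_nth:
  "fact k * fps_nth ((fps_exp (c::real) - 1) ^ r) k = c ^ k * (Stirling k r * fact r)"
proof (induction k arbitrary: r)
  case 0
  then show ?case by (cases r) (auto simp: fps_nth_power_0)
next
  case (Suc k)
  show ?case
  proof (cases r)
    case 0
    then show ?thesis by simp
  next
    case r: (Suc q)
    let ?F = "fps_exp c - 1"
    have "fps_deriv (?F ^ r) = fps_const (r * c) * (fps_exp c * ?F ^ q)"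
      unfolding fps_deriv_power by (simp add: r mult_ac flip: fps_const_mult)
    also have "fps_exp c * ?F ^ q = ?F ^ r + ?F ^ q"
      by (simp add: r algebra_simps)
    finally have "fps_nth (fps_deriv (?F ^ r)) k = r * c * (fps_nth (?F ^ r) k + fps_nth (?F ^ q) k)"
      by (simp only: fps_mult_left_const_nth fps_add_nth)
    then have "(1 + real k) * fps_nth (?F ^ r) (Suc k)
                 = r * c * (fps_nth (?F ^ r) k + fps_nth (?F ^ q) k)"
      by simp
    then have "fact k * ((1 + real k) * fps_nth (?F ^ r) (Suc k))
                 = fact k * (r * c * (fps_nth (?F ^ r) k + fps_nth (?F ^ q) k))"
      by (simp only:)
    then have "fact (Suc k) * fps_nth (?F ^ r) (Suc k)
                 = r * c * (fact k * fps_nth (?F ^ r) k + fact k * fps_nth (?F ^ q) k)"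
      by (simp only: fact_Suc of_nat_Suc distrib_left distrib_right mult_ac mult_1)
    also have "\<dots> = c ^ Suc k * (Stirling (Suc k) r * fact r)"
      unfolding Suc.IH by (simp add: r algebra_simps)
    finally show ?thesis .
  qed
qed

lemma fps_exp_sum:
  "finite A \<Longrightarrow> fps_exp (\<Sum>i\<in>A. x i :: 'b :: field_char_0) = (\<Prod>i\<in>A. fps_exp (x i))"
  by (induction A rule: finite_induct) (auto simp: fps_exp_add_mult)

text \<open>Inclusion-exclusion over the set \<open>X\<close> of allowed colours: the lists coloured
  within \<open>X\<close> number a \<open>k\<close>-th power, which is \<open>fact k\<close> times a
  coefficient of an exponential series, and the signed sum of these series factors over the
  colours.\<close>

lemma card_lists_onto:
  fixes f :: "'a \<Rightarrow> 'b"
  assumes "finite V" "finite A" "f ` V \<subseteq> A"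
  shows "real (card {xs. set xs \<subseteq> V \<and> length xs = k \<and> A \<subseteq> f ` set xs}) =
    fact k * fps_nth (\<Prod>j\<in>A. fps_exp (real (card {v \<in> V. f v = j})) - 1) k"
proof -
  let ?L = "{xs. set xs \<subseteq> V \<and> length xs = k}"
  let ?V = "\<lambda>X. {v \<in> V. f v \<in> X}"
  have finL: "finite ?L" using assms by (intro finite_lists_length_eq)
  have avoid: "(\<Sum>xs\<in>?L. of_bool (f ` set xs \<subseteq> X)) = real (\<Sum>j\<in>X. card {v \<in> V. f v = j}) ^ k"
    if "X \<subseteq> A" for X
  proof -
    have "finite X" using that assms finite_subset by blast
    have "?L \<inter> {xs. f ` set xs \<subseteq> X} = {xs. set xs \<subseteq> ?V X \<and> length xs = k}" by auto
    then have "(\<Sum>xs\<in>?L. of_bool (f ` set xs \<subseteq> X)) = real (card (?V X) ^ k)"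
      using finL assms by (simp add: card_lists_length_eq)
    also have "?V X = (\<Union>j\<in>X. {v \<in> V. f v = j})" by auto
    also have "card \<dots> = (\<Sum>j\<in>X. card {v \<in> V. f v = j})"
      using assms \<open>finite X\<close> by (subst card_UN_disjoint) auto
    finally show ?thesis by simp
  qed
  \<comment> \<open>Expansion of the product over \<open>j\<close> of 1 minus the indicator that
    colour \<open>j\<close> is missed; the factors taken from \<open>A - X\<close> together say that
    only colours in \<open>X\<close> occur.\<close>
  have onto: "of_bool (A \<subseteq> f ` set xs)
      = (\<Sum>X\<in>Pow A. (- 1) ^ card (A - X) * (of_bool (f ` set xs \<subseteq> X) :: real))"
    if xs: "xs \<in> ?L" for xs
  proof -
    have prod_of_bool: "(\<Prod>j\<in>B. of_bool (Q j) :: real) = of_bool (\<forall>j\<in>B. Q j)" if "finite B"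
      for B :: "'b set" and Q
      using that by (induction B rule: finite_induct) auto
    have sub: "f ` set xs \<subseteq> A" using xs assms(3) by auto
    have "of_bool (A \<subseteq> f ` set xs) = (\<Prod>j\<in>A. of_bool (j \<in> f ` set xs) :: real)"
      using assms by (auto simp: prod_of_bool subset_eq)
    also have "\<dots> = (\<Prod>j\<in>A. 1 + (- 1) * of_bool (j \<notin> f ` set xs))"
      by (intro prod.cong) auto
    also have "\<dots> = (\<Sum>X\<in>Pow A. (- 1) ^ card (A - X) * of_bool (\<forall>j\<in>A - X. j \<notin> f ` set xs))"
    proof -
      have "(\<Prod>j\<in>A. 1 + (- 1) * of_bool (j \<notin> f ` set xs) :: real)
          = (\<Sum>X\<in>Pow A. (\<Prod>j\<in>X. 1) * (\<Prod>j\<in>A - X. (- 1) * of_bool (j \<notin> f ` set xs)))"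
        by (rule prod_add[OF assms(2)])
      then show ?thesis
        using assms(2) by (simp only: prod.distrib prod_constant prod_of_bool finite_Diff power_one mult_1)
    qed
    also have "\<dots> = (\<Sum>X\<in>Pow A. (- 1) ^ card (A - X) * of_bool (f ` set xs \<subseteq> X))"
      using sub by (intro sum.cong refl arg_cong2[of _ _ _ _ "(*)"] arg_cong[of _ _ of_bool]) auto
    finally show ?thesis .
  qed
  have "{xs. set xs \<subseteq> V \<and> length xs = k \<and> A \<subseteq> f ` set xs} = ?L \<inter> {xs. A \<subseteq> f ` set xs}" by auto
  then have "real (card {xs. set xs \<subseteq> V \<and> length xs = k \<and> A \<subseteq> f ` set xs}) = (\<Sum>xs\<in>?L. of_bool (A \<subseteq> f ` set xs))"
    using finL by simp
  also have "\<dots> = (\<Sum>X\<in>Pow A. (- 1) ^ card (A - X) * (\<Sum>xs\<in>?L. of_bool (f ` set xs \<subseteq> X)))"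
  proof -
    have "(\<Sum>xs\<in>?L. of_bool (A \<subseteq> f ` set xs) :: real)
        = (\<Sum>xs\<in>?L. \<Sum>X\<in>Pow A. (- 1) ^ card (A - X) * of_bool (f ` set xs \<subseteq> X))"
      by (rule sum.cong[OF refl onto])
    also have "\<dots> = (\<Sum>X\<in>Pow A. \<Sum>xs\<in>?L. (- 1) ^ card (A - X) * of_bool (f ` set xs \<subseteq> X))"
      by (rule sum.swap)
    finally show ?thesis by (simp only: sum_distrib_left)
  qed
  also have "\<dots> = (\<Sum>X\<in>Pow A. (- 1) ^ card (A - X) * real (\<Sum>j\<in>X. card {v \<in> V. f v = j}) ^ k)"
    by (intro sum.cong refl) (simp only: avoid Pow_iff)
  also have "\<dots> = fact k * fps_nth (\<Sum>X\<in>Pow A. fps_exp (\<Sum>j\<in>X. real (card {v \<in> V. f v = j}))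
                                        * fps_const ((- 1) ^ card (A - X))) k"
    by (simp add: fps_sum_nth sum_distrib_left mult_ac)
  \<comment> \<open>The same subset expansion read backwards, with the signs as powers of the
    constant series -1.\<close>
  also have "(\<Sum>X\<in>Pow A. fps_exp (\<Sum>j\<in>X. real (card {v \<in> V. f v = j}))
                                        * fps_const ((- 1) ^ card (A - X)))
      = (\<Prod>j\<in>A. fps_exp (real (card {v \<in> V. f v = j})) + (- 1))"
  proof -
    have "(\<Prod>j\<in>A. fps_exp (real (card {v \<in> V. f v = j})) + (- 1))
        = (\<Sum>X\<in>Pow A. (\<Prod>j\<in>X. fps_exp (real (card {v \<in> V. f v = j}))) * (\<Prod>j\<in>A - X. - 1))"
      by (rule prod_add[OF assms(2)])
    also have "\<dots> = (\<Sum>X\<in>Pow A. fps_exp (\<Sum>j\<in>X. real (card {v \<in> V. f v = j}))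
                                        * fps_const ((- 1) ^ card (A - X)))"
    proof (intro sum.cong refl arg_cong2[of _ _ _ _ "(*)"])
      fix X assume "X \<in> Pow A"
      then have "finite X" using assms(2) finite_subset by blast
      then show "(\<Prod>j\<in>X. fps_exp (real (card {v \<in> V. f v = j})))
          = fps_exp (\<Sum>j\<in>X. real (card {v \<in> V. f v = j}))"
        by (rule fps_exp_sum[symmetric])
      have "(- 1 :: real fps) = fps_const (- 1)"
        by (simp flip: fps_const_neg)
      then show "(\<Prod>j\<in>A - X. - 1) = fps_const ((- 1 :: real) ^ card (A - X))"
        by (simp only: prod_constant fps_const_power)
    qed
    finally show ?thesis by (rule sym)
  qed
  finally show ?thesis by simp
qed

text \<open>Each edge meeting all colours has \<open>fact k\<close> orderings, which are lists
  meeting all colours. The number of such lists is largest when all classes have size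
  \<open>card V / r\<close>; lists with repeated entries only add slack.\<close>

lemma card_edges_onto:
  fixes f :: "'a \<Rightarrow> nat"
  assumes V: "finite V" and f: "f ` V \<subseteq> {..<r}" and "r > 0"
  shows "fact k * real (card {e \<in> k_subsets k V. {..<r} \<subseteq> f ` e})
           \<le> (card V / r) ^ k * (Stirling k r * fact r)"
proof -
  let ?K = "{e \<in> k_subsets k V. {..<r} \<subseteq> f ` e}"
  let ?S = "{xs. set xs \<subseteq> V \<and> length xs = k \<and> {..<r} \<subseteq> f ` set xs}"
  have finS: "finite ?S"
    by (rule finite_subset[OF _ finite_lists_length_eq[OF V, of k]]) auto
  have K: "finite e \<and> card e = k" if "e \<in> ?K" for e
    using that V by (auto simp: k_subsets_def intro: finite_subset)
  have finK: "finite ?K"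
    using V by (auto simp: k_subsets_def)
  have "card ?K * fact k = (\<Sum>e\<in>?K. card (permutations_of_set e))"
    using K by simp
  also have "\<dots> = card (\<Union>e\<in>?K. permutations_of_set e)"
  proof (rule card_UN_disjoint[symmetric, OF finK])
    show "\<forall>e\<in>?K. finite (permutations_of_set e)"
      by simp
    show "\<forall>e\<in>?K. \<forall>e'\<in>?K. e \<noteq> e' \<longrightarrow> permutations_of_set e \<inter> permutations_of_set e' = {}"
      by (auto simp: permutations_of_set_def)
  qed
  also have "\<dots> \<le> card ?S"
    using finS by (intro card_mono) (auto simp: permutations_of_set_def k_subsets_def distinct_card)
  finally have "real (card ?K * fact k) \<le> real (card ?S)"
    by (rule of_nat_mono)
  then have "fact k * real (card ?K) \<le> real (card ?S)"
    by (simp add: mult.commute)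
  also have "\<dots> = fact k * fps_nth (\<Prod>j<r. fps_exp (real (card {v \<in> V. f v = j})) - 1) k"
    by (rule card_lists_onto) (use V f in auto)
  also have "\<dots> \<le> fact k * fps_nth ((fps_exp (card V / r) - 1) ^ card {..<r}) k"
  proof (intro mult_left_mono fps_exp_prod_nth_le_mean)
    have "V = (\<Union>j<r. {v \<in> V. f v = j})" using f by auto
    then have "card V = card (\<Union>j<r. {v \<in> V. f v = j})" by (rule arg_cong)
    also have "\<dots> = (\<Sum>j<r. card {v \<in> V. f v = j})"
      using V by (intro card_UN_disjoint) auto
    finally have "card V = (\<Sum>j<r. card {v \<in> V. f v = j})" .
    then show "(\<Sum>j<r. real (card {v \<in> V. f v = j})) = card {..<r} * (card V / r)"
      using \<open>r > 0\<close> by simp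
  qed auto
  also have "\<dots> = (card V / r) ^ k * (Stirling k r * fact r)"
    by (simp add: fps_exp_minus_1_power_nth)
  finally show ?thesis .
qed

text \<open>The left side counts the lists of length \<open>k\<close> over \<open>{..<r}\<close>
  that use every letter: take the identity colouring, whose classes are singletons.\<close>

lemma Stirling_mult_fact_le: "Stirling k r * fact r \<le> r ^ k"
proof -
  have "real (Stirling k r * fact r) = fact k * fps_nth (\<Prod>j<r. fps_exp (real (card {v \<in> {..<r}. v = j})) - 1) k"
  proof -
    have "(\<Prod>j<r. fps_exp (real (card {v \<in> {..<r}. v = j})) - 1) = (\<Prod>j<r. fps_exp (1::real) - 1)"
      by (intro prod.cong) (auto simp: Collect_conv_if)
    then show ?thesis using fps_exp_minus_1_power_nth[of k 1 r] by simp
  qed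
  also have "\<dots> = real (card {xs. set xs \<subseteq> {..<r} \<and> length xs = k \<and> {..<r} \<subseteq> (\<lambda>v. v) ` set xs})"
    by (rule card_lists_onto[symmetric]) auto
  also have "\<dots> \<le> real (card {xs. set xs \<subseteq> {..<r} \<and> length xs = k})"
    by (intro of_nat_mono card_mono finite_lists_length_eq) auto
  also have "\<dots> = real (r ^ k)" by (simp add: card_lists_length_eq)
  finally show ?thesis by linarith
qed


section \<open>Exponential moment bound\<close>

text \<open>For negative \<open>y\<close>,
  \<open>1 \<le> 1 - y ^ 3 = (1 - y) * (1 + y + y^2)\<close>, and \<open>1 - y\<close> is at most
  \<open>exp (- y)\<close>.\<close>

lemma exp_le_1_plus_plus_square:
  fixes y :: real
  assumes "y \<le> 1"
  shows "exp y \<le> 1 + y + y\<^sup>2"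
proof (cases "0 \<le> y")
  case True
  then show ?thesis using assms by (intro exp_bound)
next
  case False
  have "y ^ 3 \<le> 0" using False by (simp add: power_le_zero_eq)
  \<comment> \<open>Completing the square gives \<open>(y + 1/2)^2 + 3/4\<close>.\<close>
  have pos: "0 \<le> 1 + y + y\<^sup>2" 
    using sum_squares_ge_zero[of "y + 1 / 2" "sqrt 3 / 2"]
    by (simp add: power2_eq_square algebra_simps)
  have "1 \<le> (1 - y) * (1 + y + y\<^sup>2)"
    using \<open>y ^ 3 \<le> 0\<close> by (simp add: algebra_simps power2_eq_square power3_eq_cube)
  also have "\<dots> \<le> exp (- y) * (1 + y + y\<^sup>2)"
    using exp_ge_add_one_self[of "- y"] pos by (intro mult_right_mono) auto
  finally show ?thesis
    by (simp add: exp_minus field_simps)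
qed

text \<open>Chernoff's method: Markov's inequality for the exponential of \<open>l\<close> times the
  sum, with independence, leaves factors \<open>1 + p * (exp (l * w e) - 1)\<close>. Each is at most
  \<open>exp (p * (l * w e + l^2))\<close> by the quadratic bound on \<open>exp\<close>, as
  \<open>l * w e \<le> 1\<close>.\<close>

lemma weighted_bernoulli_tail:
  fixes w :: "'a \<Rightarrow> real"
  assumes E: "finite E" and p: "0 \<le> p" "p \<le> 1" and l: "0 \<le> l" "l \<le> 1"
    and w: "\<And>e. e \<in> E \<Longrightarrow> \<bar>w e\<bar> \<le> 1"
  shows "measure_pmf.prob (Pi_pmf E False (\<lambda>_. bernoulli_pmf p))
      {X. s \<le> (\<Sum>e\<in>E. w e * of_bool (X e))}
    \<le> exp (l * (p * (\<Sum>e\<in>E. w e)) + l\<^sup>2 * (p * card E) - l * s)"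
proof -
  let ?M = "Pi_pmf E False (\<lambda>_. bernoulli_pmf p)"
  let ?u = "\<lambda>X. \<Prod>e\<in>E. exp (l * (w e * of_bool (X e)))"
  have int: "integrable (measure_pmf (bernoulli_pmf p)) g" for g :: "bool \<Rightarrow> real"
    by (rule integrable_measure_pmf_finite) simp
  have u: "?u X = exp (l * (\<Sum>e\<in>E. w e * of_bool (X e)))" for X
    using E unfolding sum_distrib_left by (rule exp_sum[symmetric])
  have "measure_pmf.prob ?M {X. s \<le> (\<Sum>e\<in>E. w e * of_bool (X e))}
      \<le> measure_pmf.prob ?M {X. exp (l * s) \<le> ?u X}"
    using l by (intro measure_pmf.finite_measure_mono) (auto simp: u mult_left_mono)
  also have "\<dots> \<le> measure_pmf.expectation ?M ?u / exp (l * s)"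
    using integral_Markov_inequality_measure[of ?M ?u "{}" "exp (l * s)"]
      integrable_prod_Pi_pmf[OF E, of "\<lambda>_. bernoulli_pmf p" "\<lambda>e x. exp (l * (w e * of_bool x))"] int
    by (simp add: prod_nonneg)
  also have "measure_pmf.expectation ?M ?u = (\<Prod>e\<in>E. 1 + p * (exp (l * w e) - 1))"
    using E p int by (subst expectation_prod_Pi_pmf) (auto simp: algebra_simps)
  also have "\<dots> \<le> (\<Prod>e\<in>E. exp (p * (l * w e + l\<^sup>2)))"
  proof (intro prod_mono conjI)
    fix e assume e: "e \<in> E"
    \<comment> \<open>A convex combination of 1 and a positive number, so the factors are
      nonnegative as \<open>prod_mono\<close> requires.\<close>
    have "0 \<le> (1 - p) + p * exp (l * w e)" using p by simp
    then show "0 \<le> 1 + p * (exp (l * w e) - 1)" by (simp add: algebra_simps)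
    have "l * w e \<le> l * 1"
      using w[OF e] l by (intro mult_left_mono) auto
    then have "exp (l * w e) \<le> 1 + l * w e + (l * w e)\<^sup>2"
      using l by (intro exp_le_1_plus_plus_square) auto
    also have "(l * w e)\<^sup>2 \<le> l\<^sup>2"
      using w[OF e] by (simp add: power_mult_distrib mult_left_le abs_square_le_1)
    finally have "p * (exp (l * w e) - 1) \<le> p * (l * w e + l\<^sup>2)"
      using p by (intro mult_left_mono) auto
    also have "1 + \<dots> \<le> exp (p * (l * w e + l\<^sup>2))"
      by (rule exp_ge_add_one_self)
    finally show "1 + p * (exp (l * w e) - 1) \<le> exp (p * (l * w e + l\<^sup>2))"
      by simp
  qed
  also have "\<dots> = exp (l * (p * (\<Sum>e\<in>E. w e)) + l\<^sup>2 * (p * card E))"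
    using E by (simp flip: exp_sum add: sum.distrib sum_distrib_left algebra_simps)
  finally show ?thesis
    by (simp add: exp_diff divide_right_mono)
qed

section \<open>Mean excess of a fixed cut\<close>

text \<open>Each of the \<open>k\<close> factors of the falling factorial is at least
  \<open>n - k\<close>, and Bernoulli's inequality bounds \<open>(1 - k / n) ^ k\<close> below by
  \<open>1 - k^2 / n\<close>.\<close>

lemma choose_mult_fact_ge:
  assumes "k \<le> n" 
  shows "real n ^ k - (real k)\<^sup>2 * real n ^ (k - 1) \<le> real (n choose k) * fact k"
proof (cases "k = 0")
  case False
  then have n: "n > 0" using assms by simp
  have "real n ^ k - (real k)\<^sup>2 * real n ^ (k - 1) = real n ^ k * (1 + k * (- (k / n)))"
    using False n by (cases k) (simp_all add: field_simps power2_eq_square)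
  also have "\<dots> \<le> real n ^ k * (1 + (- (k / n))) ^ k"
    using assms n by (intro mult_left_mono Bernoulli_inequality) (auto simp: field_simps)
  also have "\<dots> = (real n - k) ^ k"
    using n by (simp flip: power_mult_distrib add: algebra_simps)
  also have "\<dots> = (\<Prod>i<k. real n - k)" by simp
  also have "\<dots> \<le> (\<Prod>i<k. real n - i)"
    using assms by (intro prod_mono) auto
  also have "\<dots> = real (n choose k) * fact k"
    by (simp add: binomial_gbinomial gbinomial_prod_rev lessThan_atLeast0)
  finally show ?thesis .
qed auto

lemma choose_mult_fact_le: "real (n choose k) * fact k \<le> real n ^ k"
  using binomial_fact_pow[of n k] by (metis of_nat_fact of_nat_le_iff of_nat_mult of_nat_power)

lemma finite_k_subsets [simp]: "finite V \<Longrightarrow> finite (k_subsets k V)"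
  by (simp add: k_subsets_def)

lemma card_k_subsets: "finite V \<Longrightarrow> card (k_subsets k V) = card V choose k"
  by (simp add: k_subsets_def n_subsets)

text \<open>Prepares the union bound: there are infinitely many \<open>P\<close>, as values at
  \<open>i \<ge> r\<close> are free, but only \<open>r ^ n\<close> extensional labellings of
  \<open>n\<close> vertices.\<close>

lemma cut_labelling:
  assumes "is_cut r H P"
  obtains f where "f \<in> hverts H \<rightarrow>\<^sub>E {..<r}"
    "\<And>e. e \<subseteq> hverts H \<Longrightarrow> (\<forall>i<r. e \<inter> P i \<noteq> {}) \<longleftrightarrow> {..<r} \<subseteq> f ` e"
proof -
  have "\<forall>v\<in>hverts H. \<exists>i<r. v \<in> P i"
    using assms by (auto simp: is_cut_def)
  then obtain g where g: "\<And>v. v \<in> hverts H \<Longrightarrow> g v < r \<and> v \<in> P (g v)"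
    by metis
  have uniq: "i = g v" if "v \<in> hverts H" "i < r" "v \<in> P i" for i v
    using assms that g[of v] by (auto simp: is_cut_def disjoint_family_on_def)
  show ?thesis
  proof (rule that[of "restrict g (hverts H)"])
    show "restrict g (hverts H) \<in> hverts H \<rightarrow>\<^sub>E {..<r}"
      using g by auto
    show "(\<forall>i<r. e \<inter> P i \<noteq> {}) \<longleftrightarrow> {..<r} \<subseteq> restrict g (hverts H) ` e"
      if "e \<subseteq> hverts H" for e
    proof
      assume *: "\<forall>i<r. e \<inter> P i \<noteq> {}"
      show "{..<r} \<subseteq> restrict g (hverts H) ` e"
      proof
        fix i assume "i \<in> {..<r}"
        with * obtain v where "v \<in> e" "v \<in> P i" "i < r" by blast
        with uniq[of v i] that show "i \<in> restrict g (hverts H) ` e" by force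
      qed
    next
      assume *: "{..<r} \<subseteq> restrict g (hverts H) ` e"
      show "\<forall>i<r. e \<inter> P i \<noteq> {}"
      proof (intro allI impI)
        fix i assume "i < r"
        with * obtain v where "v \<in> e" "i = restrict g (hverts H) v" by blast
        with that g[of v] show "e \<inter> P i \<noteq> {}" by auto
      qed
    qed
  qed
qed

lemma Stirling_ratio_le_1:
  assumes "0 < r"
  shows "real (Stirling k r) * fact r / real r ^ k \<le> 1"
proof -
  have "real (Stirling k r * fact r) \<le> real (r ^ k)"
    by (rule of_nat_mono[OF Stirling_mult_fact_le])
  with assms show ?thesis by simp
qed

text \<open>Times the edge probability, the left side is the mean excess of a cut. After
  multiplication by \<open>fact k\<close>, the upper bound for onto edges and
  \<open>\<alpha>\<close> times the lower bound for all edges share the leading term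
  \<open>\<alpha> * card V ^ k\<close>, which cancels.\<close>

lemma sum_onto_minus_ratio_le:
  fixes f :: "'a \<Rightarrow> nat"
  assumes V: "finite V" and f: "f ` V \<subseteq> {..<r}" and r: "0 < r" and n: "k \<le> card V"
  defines "\<alpha> \<equiv> real (Stirling k r) * fact r / real r ^ k"
  shows "(\<Sum>e\<in>k_subsets k V. of_bool ({..<r} \<subseteq> f ` e) - \<alpha>) \<le> (real k)\<^sup>2 * real (card V) ^ (k - 1)"
proof -
  have \<alpha>: "0 \<le> \<alpha>" "\<alpha> \<le> 1"
    using Stirling_ratio_le_1[OF r, of k] by (auto simp: \<alpha>_def)
  let ?K = "real (card {e \<in> k_subsets k V. {..<r} \<subseteq> f ` e})" and ?N = "real (card V choose k)"
  let ?D = "(real k)\<^sup>2 * real (card V) ^ (k - 1)"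
  have sum: "(\<Sum>e\<in>k_subsets k V. of_bool ({..<r} \<subseteq> f ` e) - \<alpha>) = ?K - \<alpha> * ?N"
    by (simp add: V sum_subtractf card_k_subsets Int_def)
  have "fact k * ?K \<le> \<alpha> * real (card V) ^ k"
    using card_edges_onto[OF V f r, of k] by (simp add: \<alpha>_def power_divide mult_ac)
  moreover have "\<alpha> * (real (card V) ^ k - ?D) \<le> \<alpha> * (?N * fact k)"
    using choose_mult_fact_ge[OF n] \<alpha> by (intro mult_left_mono) auto
  moreover have "\<alpha> * ?D \<le> ?D"
    using \<alpha> by (intro mult_left_le_one_le) auto
  ultimately have "fact k * (?K - \<alpha> * ?N) \<le> ?D"
    by (simp add: algebra_simps)
  moreover have "?D \<le> fact k * ?D"
    using mult_right_mono[of 1 "fact k" ?D] by simp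
  ultimately have "fact k * (?K - \<alpha> * ?N) \<le> fact k * ?D" by linarith
  then show ?thesis unfolding sum by simp
qed

section \<open>Tail bounds for all cuts and for the number of edges\<close>

text \<open>Each of the at most \<open>r ^ n\<close> cuts has mean excess at most \<open>k\<^sup>2 n\<^sup>2\<close>, and exceeds this by
  \<open>(2 + ln r) n\<^sup>2\<close> with probability at most \<open>exp (- (1 + ln r) n)\<close>: take \<open>l = 1 / n\<close> in
  \<open>weighted_bernoulli_tail\<close>.\<close>

lemma binomial_hypergraph_excess_prob:
  fixes n k r :: nat
  assumes k: "3 \<le> k" and r: "0 < r" and n: "k \<le> n"
  defines "p \<equiv> real n powi (3 - int k)"
  shows "measure_pmf.prob (binomial_hypergraph k n p)
      {H. (\<forall>P. is_cut r H P \<longrightarrow> excess k r H P \<le> ((real k)\<^sup>2 + 2 + ln r) * (real n)\<^sup>2) \<and>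
          (real n ^ 3 - (real k)\<^sup>2 * (real n)\<^sup>2) / fact k - 2 * (real n)\<^sup>2 \<le> card (hedges H)}
    \<ge> 1 - 2 * exp (- real n)"
    (is "measure_pmf.prob _ ?G \<ge> _")
proof -
  have n0: "0 < n" using k n by simp
  have p_eq: "p = 1 / real n ^ (k - 3)"
  proof (cases "k = 3")
    case False
    then have "nat (int k - 3) = k - 3" "\<not> 0 \<le> 3 - int k" using k by auto
    then show ?thesis by (simp add: p_def power_int_def power_inverse flip: inverse_eq_divide)
  qed (simp add: p_def)
  have "1 \<le> real n ^ (k - 3)" using n0 by (intro one_le_power) simp
  then have p: "0 \<le> p" "p \<le> 1" using n0 by (simp_all add: p_eq divide_le_eq)
  have "real n ^ k = real n ^ (k - 3) * real n ^ 3"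
    using k by (simp flip: power_add)
  then have pk: "p * real n ^ k = real n ^ 3"
    using n0 by (simp add: p_eq)
  have pk1: "p * real n ^ (k - 1) = (real n)\<^sup>2"
  proof -
    have "real n ^ k = real n * real n ^ (k - 1)" using k by (cases k) auto
    then show ?thesis using pk n0 by (simp add: power2_eq_square power3_eq_cube)
  qed
  define \<alpha> where "\<alpha> = real (Stirling k r) * fact r / real r ^ k"
  define C where "C = (real k)\<^sup>2 + 2 + ln r"
  define E where "E = k_subsets k {..<n}"
  define L where "L = ({..<n} \<rightarrow>\<^sub>E {..<r})"
  define M where "M = Pi_pmf E False (\<lambda>_. bernoulli_pmf p)"
  \<comment> \<open>Contribution of a present edge to the excess: \<open>1 - \<alpha>\<close> or
    \<open>- \<alpha>\<close>, hence at most 1 in absolute value.\<close>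
  define w where "w f e = (of_bool ({..<r} \<subseteq> f ` e) - \<alpha> :: real)" for f :: "nat \<Rightarrow> nat" and e
  define H where "H X = ({..<n}, {e \<in> E. X e})" for X :: "nat set \<Rightarrow> bool"
  have fin: "finite E" "finite L" by (auto simp: E_def L_def intro: finite_PiE)
  have cardE: "card E = n choose k" by (simp add: E_def card_k_subsets)
  have \<alpha>: "0 \<le> \<alpha>" "\<alpha> \<le> 1"
    using Stirling_ratio_le_1[OF r, of k] by (auto simp: \<alpha>_def)

  have "real (n choose k) * 1 \<le> real (n choose k) * fact k"
    by (intro mult_left_mono) auto
  also have "\<dots> \<le> real n ^ k" by (rule choose_mult_fact_le)
  finally have "p * card E \<le> real n ^ 3"
    using p unfolding cardE pk[symmetric] by (intro mult_left_mono) auto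
  then have var: "(1 / real n)\<^sup>2 * (p * card E) \<le> n"
    using n0 by (simp add: field_simps power2_eq_square power3_eq_cube)
  have mean: "(real n ^ 3 - (real k)\<^sup>2 * (real n)\<^sup>2) / fact k \<le> p * card E"
  proof -
    have "p * (real n ^ k - (real k)\<^sup>2 * real n ^ (k - 1)) \<le> p * (card E * fact k)"
      using p choose_mult_fact_ge[OF n] unfolding cardE by (intro mult_left_mono) auto
    also have "p * (real n ^ k - (real k)\<^sup>2 * real n ^ (k - 1)) = real n ^ 3 - (real k)\<^sup>2 * (real n)\<^sup>2"
      unfolding right_diff_distrib pk mult.left_commute[of p] pk1 ..
    finally show ?thesis by (simp add: field_simps)
  qed

  define B where "B f = {X. C * (real n)\<^sup>2 \<le> (\<Sum>e\<in>E. w f e * of_bool (X e))}" for f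
  \<comment> \<open>Outcomes with at most \<open>p * card E - 2 * n^2\<close> edges. The weights -1
    turn this lower tail into an upper tail, so the same moment bound applies.\<close>
  define B' where "B' = {X. 2 * (real n)\<^sup>2 - p * card E \<le> (\<Sum>e\<in>E. - 1 * of_bool (X e))}"
  have B: "measure_pmf.prob M (B f) \<le> exp (- (1 + ln r) * n)" if "f \<in> L" for f
  proof -
    have "measure_pmf.prob M (B f) \<le> exp (1 / real n * (p * (\<Sum>e\<in>E. w f e))
        + (1 / real n)\<^sup>2 * (p * card E) - 1 / real n * (C * (real n)\<^sup>2))"
      unfolding M_def B_def using fin p n0 \<alpha>
      by (intro weighted_bernoulli_tail) (auto simp: w_def)
    \<comment> \<open>The mean contributes at most \<open>k^2 * n\<close> to the exponent and the
      variance at most \<open>n\<close>; the threshold subtracts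
      \<open>(k^2 + 2 + ln r) * n\<close>.\<close>
    also have "\<dots> \<le> exp (- (1 + ln r) * n)"
    proof -
      have "f ` {..<n} \<subseteq> {..<r}" using that by (auto simp: L_def)
      then have "p * (\<Sum>e\<in>E. w f e) \<le> p * ((real k)\<^sup>2 * real n ^ (k - 1))"
        unfolding E_def w_def \<alpha>_def using r n p sum_onto_minus_ratio_le[of "{..<n}" f r k]
        by (intro mult_left_mono) auto
      also have "\<dots> = (real k)\<^sup>2 * (real n)\<^sup>2" using pk1 by simp
      finally have "1 / real n * (p * (\<Sum>e\<in>E. w f e)) \<le> (real k)\<^sup>2 * n"
        using n0 by (simp add: field_simps power2_eq_square)
      moreover have "1 / real n * (C * (real n)\<^sup>2) = ((real k)\<^sup>2 + 2 + ln r) * n"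
        using n0 by (simp add: C_def power2_eq_square)
      ultimately show ?thesis using var by (simp add: algebra_simps)
    qed
    finally show ?thesis .
  qed
  have "measure_pmf.prob M B' \<le> exp (1 / real n * (p * (\<Sum>e\<in>E. - 1))
      + (1 / real n)\<^sup>2 * (p * card E) - 1 / real n * (2 * (real n)\<^sup>2 - p * card E))"
    unfolding M_def B'_def using fin p n0 by (intro weighted_bernoulli_tail) auto
  \<comment> \<open>The mean term cancels the \<open>p * card E\<close> in the threshold, and what
    remains is at most \<open>n - 2 * n\<close>.\<close>
  also have "\<dots> \<le> exp (- real n)"
    using var n0 by (simp add: right_diff_distrib power2_eq_square)
  finally have B': "measure_pmf.prob M B' \<le> exp (- real n)" .
  have "measure_pmf.prob M (\<Union>f\<in>L. B f) \<le> (\<Sum>f\<in>L. measure_pmf.prob M (B f))"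
    using fin by (intro measure_pmf.finite_measure_subadditive_finite) auto
  also have "\<dots> \<le> (\<Sum>f\<in>L. exp (- (1 + ln r) * n))"
    by (intro sum_mono B)
  \<comment> \<open>The summand \<open>ln r\<close> in \<open>C\<close> pays for the number of
    labellings.\<close>
  also have "\<dots> = real r ^ n * exp (- (1 + ln r) * n)"
    by (simp add: L_def card_PiE)
  also have "\<dots> = exp (- real n)"
  proof -
    have "real r ^ n = exp (ln r * n)" using r exp_of_nat_mult[of n "ln (real r)"] by (simp add: mult.commute)
    then show ?thesis by (simp flip: exp_add add: algebra_simps)
  qed
  finally have bad: "measure_pmf.prob M ((\<Union>f\<in>L. B f) \<union> B') \<le> 2 * exp (- real n)"
    using B' measure_Un_le[of "\<Union>f\<in>L. B f" M B'] by simp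
  have sub: "- (H -` ?G) \<subseteq> (\<Union>f\<in>L. B f) \<union> B'"
  proof
    fix X assume X: "X \<in> - (H -` ?G)"
    have cardH: "real (card (hedges (H X))) = (\<Sum>e\<in>E. of_bool (X e))"
      using fin by (simp add: H_def Int_def)
    show "X \<in> (\<Union>f\<in>L. B f) \<union> B'"
    proof (rule ccontr)
      assume *: "X \<notin> (\<Union>f\<in>L. B f) \<union> B'"
      then have "p * card E - 2 * (real n)\<^sup>2 \<le> card (hedges (H X))"
        unfolding B'_def cardH by (simp add: sum_negf)
      then have "(real n ^ 3 - (real k)\<^sup>2 * (real n)\<^sup>2) / fact k - 2 * (real n)\<^sup>2 \<le> card (hedges (H X))"
        using mean by linarith
      moreover have "excess k r (H X) P \<le> C * (real n)\<^sup>2" if P: "is_cut r (H X) P" for P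
      proof -
        obtain f where f: "f \<in> {..<n} \<rightarrow>\<^sub>E {..<r}"
          "\<And>e. e \<subseteq> {..<n} \<Longrightarrow> (\<forall>i<r. e \<inter> P i \<noteq> {}) \<longleftrightarrow> {..<r} \<subseteq> f ` e"
          using cut_labelling[OF P] unfolding H_def fst_conv by blast
        have "cut_size r (H X) P = card {e \<in> E. X e \<and> {..<r} \<subseteq> f ` e}"
          unfolding cut_size_def using f(2)
          by (intro arg_cong[of _ _ card]) (auto simp: H_def E_def k_subsets_def)
        also have "real \<dots> = (\<Sum>e\<in>E. of_bool ({..<r} \<subseteq> f ` e) * of_bool (X e))"
          using fin by (simp add: Int_def conj_commute flip: of_bool_conj)
        finally have "excess k r (H X) P = (\<Sum>e\<in>E. w f e * of_bool (X e))"
          unfolding excess_def cardH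
          by (simp only: w_def \<alpha>_def left_diff_distrib sum_subtractf sum_distrib_left)
        moreover have "X \<notin> B f" using * f(1) by (auto simp: L_def)
        ultimately show ?thesis by (simp add: B_def)
      qed
      ultimately show False using X by (auto simp: C_def)
    qed
  qed
  have "measure_pmf.prob M (- (H -` ?G)) \<le> 2 * exp (- real n)"
    using measure_pmf.finite_measure_mono[OF sub, of M] bad by simp
  moreover have "measure_pmf.prob M (- (H -` ?G)) = 1 - measure_pmf.prob M (H -` ?G)"
    using measure_pmf.prob_compl[of "H -` ?G" M] by (simp add: Compl_eq_Diff_UNIV)
  moreover have "binomial_hypergraph k n p = map_pmf H M"
    by (simp add: binomial_hypergraph_def H_def[abs_def] M_def E_def)
  ultimately show ?thesis by (simp add: C_def)
qed

section \<open>Passage to the limit\<close>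

theorem theorem1p3:
  fixes k r :: nat
  assumes "k > 3" and "2 \<le> r" and "r \<le> k"
  shows "\<exists>C C' :: real. C > 0 \<and>
    (\<lambda>n. measure_pmf.prob (binomial_hypergraph k n (real n powi (3 - int k)))
        {H. (\<forall>P. is_cut r H P \<longrightarrow> excess k r H P \<le> C * (real n)\<^sup>2) \<and>
            C * (real n)\<^sup>2 \<le> C' * real (card (hedges H)) powr (2 / 3)})
      \<longlonglongrightarrow> 1"
proof -
  define C where "C = (real k)\<^sup>2 + 2 + ln r"
  \<comment> \<open>Half the leading coefficient \<open>1 / fact k\<close> of the mean number of
    edges. \<open>C'\<close> then solves
    \<open>C' * (c * n ^ 3) powr (2 / 3) = C * n^2\<close>.\<close>
  define c :: real where "c = 1 / (2 * fact k)"
  define C' where "C' = C * c powr (- 2 / 3)"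
  have "0 \<le> ln (real r)" using assms by simp
  then have "C > 0" unfolding C_def by (intro add_pos_nonneg add_nonneg_pos) auto
  have "c > 0" by (simp add: c_def)
  have edges: "\<forall>\<^sub>F n in sequentially. c * real n ^ 3
      \<le> (real n ^ 3 - (real k)\<^sup>2 * (real n)\<^sup>2) / fact k - 2 * (real n)\<^sup>2"
  proof -
    \<comment> \<open>From this threshold on, half of the cubic term absorbs
      \<open>(k^2 / fact k + 2) * n^2\<close>.\<close>
    have "\<forall>\<^sub>F n in sequentially. 2 * ((real k)\<^sup>2 + 2 * fact k) \<le> real n"
      using filterlim_real_sequentially by (simp add: filterlim_at_top)
    then show ?thesis
    proof eventually_elim
      case (elim n)
      then have "2 * ((real k)\<^sup>2 + 2 * fact k) * (real n)\<^sup>2 \<le> real n * (real n)\<^sup>2"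
        by (intro mult_right_mono) auto
      then show ?case
        by (simp add: c_def field_simps power2_eq_square power3_eq_cube)
    qed
  qed
  let ?G = "\<lambda>n. {H. (\<forall>P. is_cut r H P \<longrightarrow> excess k r H P \<le> C * (real n)\<^sup>2) \<and>
            C * (real n)\<^sup>2 \<le> C' * real (card (hedges H)) powr (2 / 3)}"
  let ?prob = "\<lambda>n. measure_pmf.prob (binomial_hypergraph k n (real n powi (3 - int k)))"
  have lower: "\<forall>\<^sub>F n in sequentially. 1 - 2 * exp (- real n) \<le> ?prob n (?G n)"
    using edges eventually_ge_at_top[of k]
  proof eventually_elim
    case (elim n)
    have powr: "C * (real n)\<^sup>2 \<le> C' * m powr (2 / 3)" if "c * real n ^ 3 \<le> m" for m
    proof -
      have n: "real n > 0" using elim assms by simp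
      have "(real n ^ 3) powr (2 / 3) = (real n powr 3) powr (2 / 3)"
        using n by (simp add: powr_realpow flip: powr_numeral)
      also have "\<dots> = (real n)\<^sup>2"
        unfolding powr_powr using n by simp
      finally have "C' * (c * real n ^ 3) powr (2 / 3) = C * (real n)\<^sup>2"
        using \<open>c > 0\<close> by (simp add: C'_def powr_mult powr_minus field_simps)
      then have "C * (real n)\<^sup>2 = C' * (c * real n ^ 3) powr (2 / 3)" ..
      also have "\<dots> \<le> C' * m powr (2 / 3)"
        using that \<open>C > 0\<close> \<open>c > 0\<close> by (intro mult_left_mono powr_mono2) (auto simp: C'_def)
      finally show ?thesis .
    qed
    have "1 - 2 * exp (- real n) \<le> ?prob n
      {H. (\<forall>P. is_cut r H P \<longrightarrow> excess k r H P \<le> C * (real n)\<^sup>2) \<and>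
          (real n ^ 3 - (real k)\<^sup>2 * (real n)\<^sup>2) / fact k - 2 * (real n)\<^sup>2 \<le> card (hedges H)}"
      unfolding C_def using assms elim by (intro binomial_hypergraph_excess_prob) auto
    also have "\<dots> \<le> ?prob n (?G n)"
      using elim(1) by (intro measure_pmf.finite_measure_mono) (auto intro!: powr)
    finally show ?case .
  qed
  have "(\<lambda>n. ?prob n (?G n)) \<longlonglongrightarrow> 1"
  proof (rule tendsto_sandwich[OF lower _ _ tendsto_const])
    show "(\<lambda>n. 1 - 2 * exp (- real n)) \<longlonglongrightarrow> 1"
      by real_asymp
  qed (intro always_eventually allI measure_pmf.prob_le_1)
  with \<open>C > 0\<close> show ?thesis by (intro exI conjI)
qed

end
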